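(* Let $T$ be a $t$-norm such that $\sup_{0\le x<1}T(x,x)<1$. Suppose that there is $\delta>0$ such that $T(x,y)\le xy$ whenever $x,y\in[0,1]$ satisfy $x,y<\delta$. Let $S$ be a real vector space with origin $\theta$, and let $(\mathcal{U}_p)_{p\in S}$ be a Fréchet-separated, translation-invariant generalized topology (of type $V_D$) on $S$. Then $(\mathcal{U}_p)_{p\in S}$ is derivable from a Menger PN space $(S,\nu,\tau_T,\tau_{T^*})$ (that is, there exists $\nu:S\to\Delta^+$ such that $(S,\nu,\tau_T,\tau_{T^*})$ is a PN space whose strong generalized topology is $(\mathcal{U}_p)_{p\in S}$) if and only if $\mathcal{U}_\theta$ admits a countable filter base consisting of radial and circled subsets of $S$.
   Context: **Distance distribution functions.** $\Delta^+$ is the set of distance distribution functions, i.e. nondecreasing functions $F:[-\infty,+\infty]\to[0,1]$ that are left-continuous on $\mathbb{R}$, with $F(-\infty)=0$, $F(+\infty)=1$ and $F(0)=0$. It is ordered pointwise. For real $a\ge 0$, $\varepsilon_a\in\Delta^+$ is defined by $\varepsilon_a(x)=0$ if $x\le a$ and $\varepsilon_a(x)=1$ if $x>a$. **Triangle functions.** A triangle function is a map $\tau:\Delta^+\times\Delta^+\to\Delta^+$ that is commutative, associative, nondecreasing in each variable, and has $\varepsilon_0$ as identity. No continuity is required. **$t$-norms.** A $t$-norm is a binary operation $T$ on $[0,1]$ that is commutative, associative, nondecreasing in each variable, and has $1$ as identity. No continuity is required. Its associated $t$-conorm is $T^*(x,y)=1-T(1-x,1-y)$. For $F,G\in\Delta^+$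 and real $x$, define $$\tau_T(F,G)(x)=\sup\{T(F(s),G(t)):s+t=x\},\qquad \tau_{T^*}(F,G)(x)=\inf\{T^*(F(s),G(t)):s+t=x\},$$ with values $0$ at $-\infty$ and $1$ at $+\infty$. **PN spaces.** A PN space is a quadruple $(S,\nu,\tau,\tau^* )$ where $S$ is a real vector space with origin $\theta$, $\tau$ and $\tau^*$ are triangle functions, and $\nu:S\to\Delta^+$, $p\mapsto\nu_p$, satisfies for all $p,q\in S$: - (N1) $\nu_p=\varepsilon_0$ if and only if $p=\theta$; - (N2) $\nu_{-p}=\nu_p$; - (N3) $\nu_{p+q}\ge\tau(\nu_p,\nu_q)$; - (N4) $\nu_p\le\tau^*(\nu_{\lambda p},\nu_{(1-\lambda)p})$ for every $\lambda\in[0,1]$. A Menger PN space under $T$ is a PN space of the form $(S,\nu,\tau_T,\tau_{T^*})$. **Generalized topologies.** A generalized topology (of type $V_D$) on a nonempty set $S$ is a family $(\mathcal{U}_p)_{p\in S}$ where each $\mathcal{U}_p$ is a filter on $S$ such that $p\in U$ for all $U\in\mathcal{U}_p$. Elements of $\mathcal{U}_p$ are called neighborhoods at $p$. It is Fréchet-separated (Fréchet-separable) if $\bigcap_{U\in\mathcal{U}_p}U=\{p\}$ for every $p\in S$. If $S$ is a real vector space, it is translation-invariant if for all $p,q\in S$ and $U\in\mathcal{U}_p$ we have $q+U\in\mathcal{U}_{p+q}$. **Strong generalized topology.** For a PN space $(S,\nu,\tau,\tau^* )$, $p\in S$ and $t>0$, let $N_p(t)=\{q\in S:\nu_{p-q}(t)>1-t\}$.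 The strong generalized topology induced by $\nu$ is $(\mathcal{U}_p)_{p\in S}$, where $\mathcal{U}_p$ is the filter generated by the filter base $\{N_p(t):t>0\}$. **Radial and circled sets.** A subset $U$ of a real vector space is radial if $-U=U$, and circled (balanced) if $\lambda U\subseteq U$ for all real $\lambda$ with $|\lambda|\le1$.
   Formalization: For some such T, τ_T is not a triangle function, so the claim fails even for S={θ}. It is proved when τ_T and τ_{T*} are triangle functions, and for every T with "PN space" read as ν:S→Δ⁺ satisfying (N1)–(N4). *)

theory Defs
  imports "HOL-Analysis.Analysis"
begin

text \<open>Distance distribution functions. The order on them is the pointwise order \<open>\<le>\<close> on functions.\<close>

definition Delta_plus :: "(ereal \<Rightarrow> real) set" where
  "Delta_plus = {F. mono F \<and> range F \<subseteq> {0..1}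
     \<and> (\<forall>x::real. continuous (at_left (ereal x)) F)
     \<and> F (-\<infinity>) = 0 \<and> F \<infinity> = 1 \<and> F 0 = 0}"

definition eps :: "real \<Rightarrow> ereal \<Rightarrow> real" where
  "eps a x = (if x \<le> ereal a then 0 else 1)"

type_synonym ddf_op = "(ereal \<Rightarrow> real) \<Rightarrow> (ereal \<Rightarrow> real) \<Rightarrow> ereal \<Rightarrow> real"

definition triangle_function :: "ddf_op \<Rightarrow> bool" where
  "triangle_function \<tau> \<longleftrightarrow>
     (\<forall>F\<in>Delta_plus. \<forall>G\<in>Delta_plus. \<tau> F G \<in> Delta_plus) \<and>
     (\<forall>F\<in>Delta_plus. \<forall>G\<in>Delta_plus. \<tau> F G = \<tau> G F) \<and>
     (\<forall>F\<in>Delta_plus. \<forall>G\<in>Delta_plus. \<forall>H\<in>Delta_plus. \<tau> (\<tau> F G) H = \<tau> F (\<tau> G H)) \<and>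
     (\<forall>F\<in>Delta_plus. \<forall>F'\<in>Delta_plus. \<forall>G\<in>Delta_plus. \<forall>G'\<in>Delta_plus.
        F \<le> F' \<longrightarrow> G \<le> G' \<longrightarrow> \<tau> F G \<le> \<tau> F' G') \<and>
     (\<forall>F\<in>Delta_plus. \<tau> F (eps 0) = F)"

definition t_norm :: "(real \<Rightarrow> real \<Rightarrow> real) \<Rightarrow> bool" where
  "t_norm T \<longleftrightarrow>
     (\<forall>x\<in>{0..1}. \<forall>y\<in>{0..1}. T x y \<in> {0..1}) \<and>
     (\<forall>x\<in>{0..1}. \<forall>y\<in>{0..1}. T x y = T y x) \<and>
     (\<forall>x\<in>{0..1}. \<forall>y\<in>{0..1}. \<forall>z\<in>{0..1}. T (T x y) z = T x (T y z)) \<and>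
     (\<forall>x\<in>{0..1}. \<forall>x'\<in>{0..1}. \<forall>y\<in>{0..1}. \<forall>y'\<in>{0..1}.
        x \<le> x' \<longrightarrow> y \<le> y' \<longrightarrow> T x y \<le> T x' y') \<and>
     (\<forall>x\<in>{0..1}. T x 1 = x)"

definition t_conorm :: "(real \<Rightarrow> real \<Rightarrow> real) \<Rightarrow> real \<Rightarrow> real \<Rightarrow> real" where
  "t_conorm T x y = 1 - T (1 - x) (1 - y)"

definition tau_sup :: "(real \<Rightarrow> real \<Rightarrow> real) \<Rightarrow> ddf_op" where
  "tau_sup T F G x = (case x of
       ereal r \<Rightarrow> Sup {T (F (ereal s)) (G (ereal t)) | s t. s + t = r}
     | PInfty \<Rightarrow> 1
     | MInfty \<Rightarrow> 0)"

text \<open>The first argument is the conorm itself: \<open>\<tau>\<^sub>T\<^sub>*\<close> is \<open>tau_inf (t_conorm T)\<close>.\<close>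

definition tau_inf :: "(real \<Rightarrow> real \<Rightarrow> real) \<Rightarrow> ddf_op" where
  "tau_inf C F G x = (case x of
       ereal r \<Rightarrow> Inf {C (F (ereal s)) (G (ereal t)) | s t. s + t = r}
     | PInfty \<Rightarrow> 1
     | MInfty \<Rightarrow> 0)"

text \<open>
  The axioms (N1)--(N4) are kept apart from the requirement that \<open>\<tau>\<close> and \<open>\<tau>'\<close> be triangle
  functions, because \<open>tau_sup T\<close> need not be one when \<open>T\<close> is not left-continuous: if
  \<open>T x y = 1/4\<close> for \<open>x, y \<in> [1/2, 1)\<close> and \<open>T x y = 0\<close> elsewhere on \<open>[0, 1)\<^sup>2\<close>, then
  \<open>tau_sup T F F\<close>, for \<open>F\<close> the uniform distribution on \<open>[0, 1]\<close>, jumps from \<open>0\<close> to \<open>1/4\<close> at the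
  point \<open>1\<close> and is not left-continuous there.\<close>

definition pn_axioms ::
    "('a::real_vector \<Rightarrow> ereal \<Rightarrow> real) \<Rightarrow> ddf_op \<Rightarrow> ddf_op \<Rightarrow> bool" where
  "pn_axioms \<nu> \<tau> \<tau>' \<longleftrightarrow>
     (\<forall>p. \<nu> p \<in> Delta_plus) \<and>
     (\<forall>p. \<nu> p = eps 0 \<longleftrightarrow> p = 0) \<and>
     (\<forall>p. \<nu> (- p) = \<nu> p) \<and>
     (\<forall>p q. \<tau> (\<nu> p) (\<nu> q) \<le> \<nu> (p + q)) \<and>
     (\<forall>p. \<forall>l\<in>{0..1}. \<nu> p \<le> \<tau>' (\<nu> (l *\<^sub>R p)) (\<nu> ((1 - l) *\<^sub>R p)))"

definition pn_space ::
    "('a::real_vector \<Rightarrow> ereal \<Rightarrow> real) \<Rightarrow> ddf_op \<Rightarrow> ddf_op \<Rightarrow> bool" where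
  "pn_space \<nu> \<tau> \<tau>' \<longleftrightarrow> triangle_function \<tau> \<and> triangle_function \<tau>' \<and> pn_axioms \<nu> \<tau> \<tau>'"

definition menger_pn_space ::
    "(real \<Rightarrow> real \<Rightarrow> real) \<Rightarrow> ('a::real_vector \<Rightarrow> ereal \<Rightarrow> real) \<Rightarrow> bool" where
  "menger_pn_space T \<nu> \<longleftrightarrow> pn_space \<nu> (tau_sup T) (tau_inf (t_conorm T))"

definition filter_sets :: "'a filter \<Rightarrow> 'a set set" where
  "filter_sets \<F> = {U. \<forall>\<^sub>F x in \<F>. x \<in> U}"

definition generalized_topology :: "('a \<Rightarrow> 'a filter) \<Rightarrow> bool" where
  "generalized_topology \<U> \<longleftrightarrow> (\<forall>p. \<forall>U\<in>filter_sets (\<U> p). p \<in> U)"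

definition frechet_separated :: "('a \<Rightarrow> 'a filter) \<Rightarrow> bool" where
  "frechet_separated \<U> \<longleftrightarrow> (\<forall>p. \<Inter>(filter_sets (\<U> p)) = {p})"

definition translation_invariant :: "('a::real_vector \<Rightarrow> 'a filter) \<Rightarrow> bool" where
  "translation_invariant \<U> \<longleftrightarrow>
     (\<forall>p q. \<forall>U\<in>filter_sets (\<U> p). (\<lambda>x. q + x) ` U \<in> filter_sets (\<U> (p + q)))"

definition filter_base_of :: "'a set set \<Rightarrow> 'a filter \<Rightarrow> bool" where
  "filter_base_of B \<F> \<longleftrightarrow> B \<subseteq> filter_sets \<F> \<and> (\<forall>U\<in>filter_sets \<F>. \<exists>V\<in>B. V \<subseteq> U)"

definition strong_nbhd :: "('a::real_vector \<Rightarrow> ereal \<Rightarrow> real) \<Rightarrow> 'a \<Rightarrow> real \<Rightarrow> 'a set" where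
  "strong_nbhd \<nu> p t = {q. \<nu> (p - q) (ereal t) > 1 - t}"

definition strong_generalized_topology ::
    "('a::real_vector \<Rightarrow> ereal \<Rightarrow> real) \<Rightarrow> 'a \<Rightarrow> 'a filter" where
  "strong_generalized_topology \<nu> p = (INF t\<in>{0<..}. principal (strong_nbhd \<nu> p t))"

definition radial :: "'a::real_vector set \<Rightarrow> bool" where
  "radial U \<longleftrightarrow> uminus ` U = U"

definition circled :: "'a::real_vector set \<Rightarrow> bool" where
  "circled U \<longleftrightarrow> (\<forall>l::real. \<bar>l\<bar> \<le> 1 \<longrightarrow> (\<lambda>x. l *\<^sub>R x) ` U \<subseteq> U)"

end

theory Submission
  imports Defs
begin

text \<open>
  Membership of \<open>q\<close> in \<open>N\<^sub>p(t)\<close> only compares \<open>\<nu>\<^bsub>p-q\<^esub>(t)\<close> with \<open>1 - t\<close>, so a distance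
  distribution function that takes a single value \<open>c\<close> on \<open>(0, \<infinity>)\<close> is already able to record
  how close \<open>p\<close> is to \<open>\<theta>\<close>. Since \<open>\<beta> = sup {T(x,x) | x < 1}\<close> is less than \<open>1\<close>, all these values
  can be taken from \<open>[\<beta>, 1]\<close>. The triangle inequality (N3) then asks that
  \<open>T(c\<^sub>p, c\<^sub>q) \<le> c\<^bsub>p+q\<^esub>\<close>, and this cannot fail: the level \<open>1\<close> is reserved for the origin, where
  \<open>T(1, c\<^sub>q) = c\<^sub>q\<close>, and for \<open>c\<^sub>p, c\<^sub>q < 1\<close> the left side is at most \<open>\<beta>\<close>. So (N3) puts no
  constraint on how the neighborhoods of \<open>\<theta>\<close> add up (\<open>pn_axioms_level_ddf\<close>).
  Given a decreasing base \<open>V\<^sub>0 \<supseteq> V\<^sub>1 \<supseteq> \<dots>\<close> of circled sets at \<open>\<theta>\<close>, the value \<open>c\<^sub>p\<close> is chosen so that \<open>p \<in> V\<^sub>n\<close> means \<open>c\<^sub>p > 1 - (1 - \<beta>)/(n + 1)\<close>; circledness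
  makes \<open>c\<close> nonincreasing along rays from \<open>\<theta>\<close>, which gives (N4), separation gives (N1), and the
  sets \<open>N\<^sub>p((1 - \<beta>)/(n + 1))\<close> are exactly the translates \<open>p + V\<^sub>n\<close>
  (\<open>strong_generalized_topology_level_ddf\<close>).

  Conversely, in the infimum that defines \<open>\<tau>\<^bsub>T*\<^esub>(F, G)(x)\<close> the splitting \<open>x = x + 0\<close> contributes
  \<open>T*(F(x), 0) = F(x)\<close>. So (N4), with (N2), forces \<open>\<nu>\<^sub>p \<le> \<nu>\<^bsub>\<lambda>p\<^esub>\<close> for \<open>\<bar>\<lambda>\<bar> \<le> 1\<close>
  (\<open>pn_axioms_scale\<close>), which says that every \<open>N\<^sub>\<theta>(t)\<close> is circled, and the sets
  \<open>N\<^sub>\<theta>(1/(n + 1))\<close> form the required base.\<close>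

section \<open>Triangular norms and conorms\<close>

lemma t_norm_unit:
  assumes "t_norm T" "x \<in> {0..1}" "y \<in> {0..1}"
  shows "0 \<le> T x y" "T x y \<le> 1"
proof -
  have "T x y \<in> {0..1}"
    using assms unfolding t_norm_def by blast
  then show "0 \<le> T x y" "T x y \<le> 1"
    by auto
qed

lemma t_norm_mono:
  assumes "t_norm T" "x \<in> {0..1}" "y \<in> {0..1}" "x' \<in> {0..1}" "y' \<in> {0..1}" "x \<le> x'" "y \<le> y'"
  shows "T x y \<le> T x' y'"
proof -
  have "\<forall>x\<in>{0..1}. \<forall>x'\<in>{0..1}. \<forall>y\<in>{0..1}. \<forall>y'\<in>{0..1}.
      x \<le> x' \<longrightarrow> y \<le> y' \<longrightarrow> T x y \<le> T x' y'"
    using assms(1) unfolding t_norm_def by (elim conjE)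
  then show ?thesis
    using assms(2-) by blast
qed

lemma t_norm_one_right:
  assumes "t_norm T" "x \<in> {0..1}"
  shows "T x 1 = x"
  using assms unfolding t_norm_def by blast

lemma t_norm_commute:
  assumes "t_norm T" "x \<in> {0..1}" "y \<in> {0..1}"
  shows "T x y = T y x"
  using assms unfolding t_norm_def by blast

lemma t_norm_le_left:
  assumes "t_norm T" "x \<in> {0..1}" "y \<in> {0..1}"
  shows "T x y \<le> x"
  using t_norm_mono[of T x y x 1] t_norm_one_right[of T x] assms by auto

lemma t_norm_le_right:
  assumes "t_norm T" "x \<in> {0..1}" "y \<in> {0..1}"
  shows "T x y \<le> y"
  using t_norm_le_left[of T y x] t_norm_commute[of T x y] assms by simp

lemma t_norm_le_diagonal_SUP:
  assumes T: "t_norm T" and "x \<in> {0..<1}" "y \<in> {0..<1}"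
  shows "T x y \<le> (SUP x\<in>{0..<1}. T x x)"
proof -
  have "T x y \<le> T (max x y) (max x y)"
    using assms by (intro t_norm_mono[OF T]) auto
  also have "\<dots> \<le> (SUP x\<in>{0..<1}. T x x)"
  proof (rule cSUP_upper)
    show "bdd_above ((\<lambda>x. T x x) ` {0..<1})"
      using t_norm_unit(2)[OF T] by (intro bdd_aboveI2[where M = 1]) auto
  qed (use assms in auto)
  finally show ?thesis .
qed

lemma t_conorm_ge:
  assumes "t_norm T" "x \<in> {0..1}" "y \<in> {0..1}"
  shows "x \<le> t_conorm T x y" "y \<le> t_conorm T x y"
  using t_norm_le_left[of T "1 - x" "1 - y"] t_norm_le_right[of T "1 - x" "1 - y"] assms
  by (auto simp: t_conorm_def)

lemma t_conorm_zero_right: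
  assumes "t_norm T" "x \<in> {0..1}"
  shows "t_conorm T x 0 = x"
  using t_norm_one_right[of T "1 - x"] assms by (simp add: t_conorm_def)

section \<open>The strong generalized topology\<close>

lemma Delta_plus_unit: "F \<in> Delta_plus \<Longrightarrow> F x \<in> {0..1}"
  unfolding Delta_plus_def by blast

lemma Delta_plus_mono: "F \<in> Delta_plus \<Longrightarrow> x \<le> y \<Longrightarrow> F x \<le> F y"
  by (auto simp: Delta_plus_def mono_def)

lemma Delta_plus_at_zero: "F \<in> Delta_plus \<Longrightarrow> F 0 = 0"
  by (auto simp: Delta_plus_def)

lemma strong_nbhd_mono:
  assumes "\<And>p. \<nu> p \<in> Delta_plus" "s \<le> t"
  shows "strong_nbhd \<nu> p s \<subseteq> strong_nbhd \<nu> p t"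
proof
  fix q assume "q \<in> strong_nbhd \<nu> p s"
  moreover have "\<nu> (p - q) (ereal s) \<le> \<nu> (p - q) (ereal t)"
    using assms by (intro Delta_plus_mono) auto
  ultimately show "q \<in> strong_nbhd \<nu> p t"
    using assms(2) by (simp add: strong_nbhd_def)
qed

text \<open>The neighborhoods \<open>N\<^sub>p(t)\<close> are nested, so the infimum of the principal filters that they
  generate needs only one of them at a time.\<close>

lemma filter_sets_strong_generalized_topology:
  assumes "\<And>p. \<nu> p \<in> Delta_plus"
  shows "U \<in> filter_sets (strong_generalized_topology \<nu> p)
    \<longleftrightarrow> (\<exists>t>0. strong_nbhd \<nu> p t \<subseteq> U)"
proof -
  have "eventually (\<lambda>x. x \<in> U) (INF t\<in>{0<..}. principal (strong_nbhd \<nu> p t))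
    \<longleftrightarrow> (\<exists>t\<in>{0<..}. eventually (\<lambda>x. x \<in> U) (principal (strong_nbhd \<nu> p t)))"
  proof (rule eventually_INF_base)
    fix s t :: real assume "s \<in> {0<..}" "t \<in> {0<..}"
    then show "\<exists>r\<in>{0<..}. principal (strong_nbhd \<nu> p r)
        \<le> inf (principal (strong_nbhd \<nu> p s)) (principal (strong_nbhd \<nu> p t))"
      using strong_nbhd_mono[of \<nu> "min s t" s p] strong_nbhd_mono[of \<nu> "min s t" t p] assms
      by (intro bexI[of _ "min s t"]) auto
  qed auto
  then show ?thesis
    by (auto simp: filter_sets_def strong_generalized_topology_def eventually_principal subset_iff)
qed

lemma filter_eq_iff_filter_sets: "F = G \<longleftrightarrow> filter_sets F = filter_sets G"
proof
  assume eq: "filter_sets F = filter_sets G"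
  show "F = G"
    unfolding filter_eq_iff
  proof
    fix P
    have "{x. P x} \<in> filter_sets F \<longleftrightarrow> {x. P x} \<in> filter_sets G"
      using eq by simp
    then show "eventually P F \<longleftrightarrow> eventually P G"
      by (simp add: filter_sets_def)
  qed
qed simp

lemma filter_sets_superset: "U \<in> filter_sets F \<Longrightarrow> U \<subseteq> V \<Longrightarrow> V \<in> filter_sets F"
  by (auto simp: filter_sets_def elim: eventually_mono)

section \<open>Circled neighborhoods in a Menger space\<close>

text \<open>The splitting \<open>x = x + 0\<close> contributes \<open>T*(F(x), G(0)) = T*(F(x), 0) = F(x)\<close> to the
  infimum.\<close>

lemma tau_inf_conorm_le_left:
  assumes T: "t_norm T" and F: "F \<in> Delta_plus" and G: "G \<in> Delta_plus"
  shows "tau_inf (t_conorm T) F G (ereal x) \<le> F (ereal x)"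
proof -
  let ?S = "{t_conorm T (F (ereal s)) (G (ereal t)) | s t. s + t = x}"
  have "bdd_below ?S"
  proof (rule bdd_belowI[of _ 0], clarify)
    fix s t
    show "0 \<le> t_conorm T (F (ereal s)) (G (ereal t))"
      using t_conorm_ge(1)[OF T Delta_plus_unit[OF F] Delta_plus_unit[OF G], of s t]
        Delta_plus_unit[OF F, of s] by auto
  qed
  moreover have "F (ereal x) \<in> ?S"
    using t_conorm_zero_right[OF T Delta_plus_unit[OF F], of x] Delta_plus_at_zero[OF G]
    by (intro CollectI exI[of _ x] exI[of _ 0]) (simp add: zero_ereal_def)
  ultimately show ?thesis
    by (simp add: tau_inf_def cInf_lower)
qed

text \<open>(N4) covers scalars in \<open>[0, 1]\<close>, and (N2) carries the inequality over to negative
  ones.\<close>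

lemma pn_axioms_scale:
  assumes T: "t_norm T" and pn: "pn_axioms \<nu> \<tau> (tau_inf (t_conorm T))" and l: "\<bar>l\<bar> \<le> 1"
  shows "\<nu> p (ereal x) \<le> \<nu> (l *\<^sub>R p) (ereal x)"
proof -
  have D: "\<And>p. \<nu> p \<in> Delta_plus" and sym: "\<And>p. \<nu> (- p) = \<nu> p"
    and n4: "\<And>p l. l \<in> {0..1} \<Longrightarrow>
      \<nu> p \<le> tau_inf (t_conorm T) (\<nu> (l *\<^sub>R p)) (\<nu> ((1 - l) *\<^sub>R p))"
    using pn by (auto simp: pn_axioms_def)
  have "\<nu> p (ereal x)
      \<le> tau_inf (t_conorm T) (\<nu> (\<bar>l\<bar> *\<^sub>R p)) (\<nu> ((1 - \<bar>l\<bar>) *\<^sub>R p)) (ereal x)"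
    using n4[of "\<bar>l\<bar>" p] l by (simp add: le_fun_def)
  also have "\<dots> \<le> \<nu> (\<bar>l\<bar> *\<^sub>R p) (ereal x)"
    by (intro tau_inf_conorm_le_left T D)
  also have "\<nu> (\<bar>l\<bar> *\<^sub>R p) = \<nu> (l *\<^sub>R p)"
    using sym[of "l *\<^sub>R p"] by (cases "0 \<le> l") auto
  finally show ?thesis .
qed

lemma circled_imp_radial:
  assumes "circled U"
  shows "radial U"
proof -
  have neg: "- x \<in> U" if "x \<in> U" for x
    using assms[unfolded circled_def, rule_format, of "-1"] that by auto
  have "x \<in> uminus ` U" if "x \<in> U" for x
    using neg[OF that] by (intro image_eqI[of _ _ "- x"]) auto
  with neg show ?thesis
    by (auto simp: radial_def)
qed

lemma circled_strong_nbhd_zero: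
  assumes "t_norm T" and pn: "pn_axioms \<nu> \<tau> (tau_inf (t_conorm T))"
  shows "circled (strong_nbhd \<nu> 0 t)"
  unfolding circled_def
proof (intro allI impI image_subsetI)
  fix l :: real and q assume l: "\<bar>l\<bar> \<le> 1" and q: "q \<in> strong_nbhd \<nu> 0 t"
  have "\<nu> (- q) (ereal t) \<le> \<nu> (l *\<^sub>R (- q)) (ereal t)"
    using assms l by (intro pn_axioms_scale)
  then show "l *\<^sub>R q \<in> strong_nbhd \<nu> 0 t"
    using q by (simp add: strong_nbhd_def)
qed

lemma pn_axioms_imp_countable_circled_base:
  assumes T: "t_norm T" and pn: "pn_axioms \<nu> \<tau> (tau_inf (t_conorm T))"
  shows "\<exists>B. countable B \<and> filter_base_of B (strong_generalized_topology \<nu> 0)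
    \<and> (\<forall>U\<in>B. radial U \<and> circled U)"
proof -
  have D: "\<And>p. \<nu> p \<in> Delta_plus"
    using pn by (auto simp: pn_axioms_def)
  let ?N = "\<lambda>n. strong_nbhd \<nu> 0 (1 / real (Suc n))"
  have "filter_base_of (range ?N) (strong_generalized_topology \<nu> 0)"
    unfolding filter_base_of_def
  proof (intro conjI ballI)
    show "range ?N \<subseteq> filter_sets (strong_generalized_topology \<nu> 0)"
    proof (rule image_subsetI)
      fix n
      have "0 < 1 / real (Suc n)"
        by simp
      then show "?N n \<in> filter_sets (strong_generalized_topology \<nu> 0)"
        unfolding filter_sets_strong_generalized_topology[OF D] by blast
    qed
  next
    fix U assume "U \<in> filter_sets (strong_generalized_topology \<nu> 0)"
    then obtain t where t: "t > 0" "strong_nbhd \<nu> 0 t \<subseteq> U"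
      unfolding filter_sets_strong_generalized_topology[OF D] by blast
    obtain n where "1 / real (Suc n) < t"
      using nat_approx_posE[OF t(1)] .
    then have "?N n \<subseteq> U"
      using strong_nbhd_mono[of \<nu> "1 / real (Suc n)" t 0] D t(2) by auto
    then show "\<exists>V\<in>range ?N. V \<subseteq> U"
      by blast
  qed
  then show ?thesis
    using circled_strong_nbhd_zero[OF T pn] circled_imp_radial
    by (intro exI[of _ "range ?N"]) auto
qed

section \<open>Distance distribution functions with one level\<close>

text \<open>The jump at \<open>\<infinity>\<close> is allowed, because left-continuity is demanded at real points only. It is
  what lets the level stay below \<open>1\<close> on the whole half-line.\<close>

definition level_ddf :: "real \<Rightarrow> ereal \<Rightarrow> real" where
  "level_ddf c x = (if x \<le> 0 then 0 else if x = \<infinity> then 1 else c)"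

lemma level_ddf_ereal [simp]: "level_ddf c (ereal x) = (if x \<le> 0 then 0 else c)"
  by (simp add: level_ddf_def)

lemma level_ddf_unit: "c \<in> {0..1} \<Longrightarrow> level_ddf c x \<in> {0..1}"
  by (auto simp: level_ddf_def)

lemma level_ddf_in_Delta_plus:
  assumes c: "c \<in> {0..1}"
  shows "level_ddf c \<in> Delta_plus"
proof -
  have "continuous (at_left (ereal x)) (level_ddf c)" for x
  proof -
    have "eventually (\<lambda>y. level_ddf c y = level_ddf c (ereal x)) (at_left (ereal x))"
    proof (cases "x \<le> 0")
      case True
      have "eventually (\<lambda>y. y < ereal x) (at_left (ereal x))"
        by (simp add: eventually_at_filter)
      then show ?thesis
      proof (rule eventually_mono)
        fix y assume "y < ereal x"
        moreover have "ereal x \<le> 0"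
          using True by simp
        ultimately have "y \<le> 0"
          by order
        then show "level_ddf c y = level_ddf c (ereal x)"
          using True by (simp add: level_ddf_def)
      qed
    next
      case False
      then have "eventually (\<lambda>y. y \<in> {0<..<ereal x}) (at_left (ereal x))"
        by (intro eventually_at_leftI[of 0]) auto
      then show ?thesis
        by (rule eventually_mono) (use False in \<open>auto simp: level_ddf_def\<close>)
    qed
    then have "(level_ddf c \<longlongrightarrow> level_ddf c (ereal x)) (at_left (ereal x))"
      by (rule tendsto_eventually)
    then show ?thesis
      by (simp add: continuous_within)
  qed
  moreover have "mono (level_ddf c)"
    using c by (auto simp: mono_def level_ddf_def)
  moreover have "range (level_ddf c) \<subseteq> {0..1}"
    using level_ddf_unit[OF c] by blast
  ultimately show ?thesis
    by (auto simp: Delta_plus_def level_ddf_def)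
qed

lemma level_ddf_eq_eps_zero_iff: "level_ddf c = eps 0 \<longleftrightarrow> c = 1"
proof
  assume "level_ddf c = eps 0"
  then have "level_ddf c (ereal 1) = eps 0 (ereal 1)"
    by simp
  then show "c = 1"
    by (simp add: eps_def)
next
  assume "c = 1"
  then show "level_ddf c = eps 0"
    by (auto simp: fun_eq_iff level_ddf_def eps_def zero_ereal_def)
qed

text \<open>A splitting \<open>s + t\<close> with \<open>s \<le> 0\<close> or \<open>t \<le> 0\<close> contributes \<open>0\<close> to the supremum, because
  \<open>T\<close> lies below both of its arguments. Otherwise \<open>s + t > 0\<close>, and all three functions are at
  their levels.\<close>

lemma tau_sup_level_ddf_le:
  assumes T: "t_norm T" and c: "a \<in> {0..1}" "b \<in> {0..1}" "c \<in> {0..1}" and le: "T a b \<le> c"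
  shows "tau_sup T (level_ddf a) (level_ddf b) \<le> level_ddf c"
proof (rule le_funI)
  fix x
  show "tau_sup T (level_ddf a) (level_ddf b) x \<le> level_ddf c x"
  proof (cases x)
    case (real r)
    have "Sup {T (level_ddf a (ereal s)) (level_ddf b (ereal t)) | s t. s + t = r}
        \<le> level_ddf c (ereal r)"
    proof (rule cSup_least)
      show "{T (level_ddf a (ereal s)) (level_ddf b (ereal t)) | s t. s + t = r} \<noteq> {}"
        using add_0_right[of r] by blast
    next
      fix y assume "y \<in> {T (level_ddf a (ereal s)) (level_ddf b (ereal t)) | s t. s + t = r}"
      then obtain s t where y: "y = T (level_ddf a (ereal s)) (level_ddf b (ereal t))"
        and r: "s + t = r" by blast
      show "y \<le> level_ddf c (ereal r)"
      proof (cases "0 < s \<and> 0 < t")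
        case True
        then show ?thesis
          using le y r by simp
      next
        case False
        then have "y \<le> 0"
          using t_norm_le_left[OF T level_ddf_unit[OF c(1)] level_ddf_unit[OF c(2)], of s t]
            t_norm_le_right[OF T level_ddf_unit[OF c(1)] level_ddf_unit[OF c(2)], of s t] y
          by (auto split: if_splits)
        then show ?thesis
          using level_ddf_unit[OF c(3), of "ereal r"] by (auto split: if_splits)
      qed
    qed
    then show ?thesis
      by (simp add: tau_sup_def real)
  qed (auto simp: tau_sup_def level_ddf_def)
qed

text \<open>Of two real summands with a positive sum one is positive, and there its function has reached
  its level; a conorm lies above both of its arguments.\<close>

lemma level_ddf_le_tau_inf:
  assumes T: "t_norm T" and c: "a \<in> {0..1}" "b \<in> {0..1}" and le: "c \<le> a" "c \<le> b"
  shows "level_ddf c \<le> tau_inf (t_conorm T) (level_ddf a) (level_ddf b)"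
proof (rule le_funI)
  fix x
  show "level_ddf c x \<le> tau_inf (t_conorm T) (level_ddf a) (level_ddf b) x"
  proof (cases x)
    case (real r)
    have "level_ddf c (ereal r)
        \<le> Inf {t_conorm T (level_ddf a (ereal s)) (level_ddf b (ereal t)) | s t. s + t = r}"
    proof (rule cInf_greatest)
      show "{t_conorm T (level_ddf a (ereal s)) (level_ddf b (ereal t)) | s t. s + t = r} \<noteq> {}"
        using add_0_right[of r] by blast
    next
      fix y
      assume "y \<in> {t_conorm T (level_ddf a (ereal s)) (level_ddf b (ereal t)) | s t. s + t = r}"
      then obtain s t where y: "y = t_conorm T (level_ddf a (ereal s)) (level_ddf b (ereal t))"
        and r: "s + t = r" by blast
      have "level_ddf a (ereal s) \<le> y" "level_ddf b (ereal t) \<le> y"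
        unfolding y by (intro t_conorm_ge T level_ddf_unit c)+
      then show "level_ddf c (ereal r) \<le> y"
        using c le r by (auto split: if_splits)
    qed
    then show ?thesis
      by (simp add: tau_inf_def real)
  qed (auto simp: tau_inf_def level_ddf_def)
qed

text \<open>If one of \<open>p\<close>, \<open>q\<close> is the origin, (N3) compares a level with itself, since \<open>T\<close> has unit \<open>1\<close>;
  otherwise \<open>T\<close> brings the two levels down to at most \<open>b\<close>, which no level falls below.\<close>

lemma pn_axioms_level_ddf:
  fixes c :: "'a::real_vector \<Rightarrow> real"
  assumes T: "t_norm T"
    and T_le: "\<And>x y. x \<in> {0..<1} \<Longrightarrow> y \<in> {0..<1} \<Longrightarrow> T x y \<le> b"
    and b: "0 \<le> b" "\<And>p. b \<le> c p" "\<And>p. c p \<le> 1"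
    and one: "\<And>p. c p = 1 \<longleftrightarrow> p = 0"
    and scale: "\<And>l p. \<bar>l\<bar> \<le> 1 \<Longrightarrow> c p \<le> c (l *\<^sub>R p)"
  shows "pn_axioms (\<lambda>p. level_ddf (c p)) (tau_sup T) (tau_inf (t_conorm T))"
proof -
  have c: "c p \<in> {0..1}" for p
    using b(1) b(2)[of p] b(3)[of p] by auto
  have sym: "c (- p) = c p" for p
    using scale[of "-1" p] scale[of "-1" "- p"] by simp
  have "T (c p) (c q) \<le> c (p + q)" for p q
  proof (cases "p = 0 \<or> q = 0")
    case True
    then show ?thesis
      using t_norm_le_left[OF T c c, of p q] t_norm_le_right[OF T c c, of p q] by auto
  next
    case False
    then have "c p < 1" "c q < 1"
      using one[of p] one[of q] b(3)[of p] b(3)[of q] by auto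
    then have "T (c p) (c q) \<le> b"
      using c[of p] c[of q] by (intro T_le) auto
    then show ?thesis
      using b(2)[of "p + q"] by simp
  qed
  then have "tau_sup T (level_ddf (c p)) (level_ddf (c q)) \<le> level_ddf (c (p + q))" for p q
    by (intro tau_sup_level_ddf_le T c)
  moreover have "level_ddf (c p)
      \<le> tau_inf (t_conorm T) (level_ddf (c (l *\<^sub>R p))) (level_ddf (c ((1 - l) *\<^sub>R p)))"
    if "l \<in> {0..1}" for p l
    using that by (intro level_ddf_le_tau_inf T c scale) auto
  ultimately show ?thesis
    unfolding pn_axioms_def
    using c sym one by (auto simp: level_ddf_eq_eps_zero_iff intro!: level_ddf_in_Delta_plus)
qed

section \<open>Levels from a decreasing neighborhood base\<close>

text \<open>The points outside \<open>V 0\<close> get the least level \<open>b\<close>, and leaving a smaller set costs less, so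
  that the levels of points that leave later and later sets tend to \<open>1\<close>.\<close>

definition nbhd_level :: "real \<Rightarrow> (nat \<Rightarrow> 'a set) \<Rightarrow> 'a \<Rightarrow> real" where
  "nbhd_level b V p =
    (if \<forall>n. p \<in> V n then 1 else 1 - (1 - b) / real (Suc (LEAST n. p \<notin> V n)))"

lemma nbhd_level_bounds:
  assumes "b < 1"
  shows "b \<le> nbhd_level b V p" "nbhd_level b V p \<le> 1"
proof -
  have "(1 - b) / real (Suc n) \<le> 1 - b" for n
    using assms divide_left_mono[of 1 "real (Suc n)" "1 - b"] by simp
  then have "b \<le> 1 - (1 - b) / real (Suc n)" for n
    by (simp add: algebra_simps)
  then show "b \<le> nbhd_level b V p" "nbhd_level b V p \<le> 1"
    using assms by (auto simp: nbhd_level_def simp del: of_nat_Suc)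
qed

lemma nbhd_level_eq_one_iff: "b < 1 \<Longrightarrow> nbhd_level b V p = 1 \<longleftrightarrow> (\<forall>n. p \<in> V n)"
  by (simp add: nbhd_level_def)

lemma mem_iff_nbhd_level_gt:
  assumes b: "b < 1" and V: "decseq V"
  shows "p \<in> V n \<longleftrightarrow> 1 - (1 - b) / real (Suc n) < nbhd_level b V p"
proof (cases "\<forall>n. p \<in> V n")
  case True
  then show ?thesis
    using b by (simp add: nbhd_level_def)
next
  case False
  let ?m = "LEAST n. p \<notin> V n"
  have m: "p \<notin> V ?m"
    using False LeastI_ex[of "\<lambda>n. p \<notin> V n"] by blast
  have "p \<in> V n \<longleftrightarrow> n < ?m"
    using m not_less_Least[of n "\<lambda>n. p \<notin> V n"] decseqD[OF V, of ?m n] by (meson not_less subsetD)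
  also have "\<dots> \<longleftrightarrow> (1 - b) * real (Suc n) < (1 - b) * real (Suc ?m)"
    using b by (subst mult_less_cancel_left_pos) auto
  also have "\<dots> \<longleftrightarrow> (1 - b) / real (Suc ?m) < (1 - b) / real (Suc n)"
    by (simp add: divide_less_eq pos_less_divide_eq ac_simps del: of_nat_Suc)
  also have "\<dots> \<longleftrightarrow> 1 - (1 - b) / real (Suc n) < nbhd_level b V p"
    unfolding nbhd_level_def using False by (simp only: if_False) linarith
  finally show ?thesis .
qed

lemma nbhd_level_mono:
  assumes b: "b < 1" and V: "decseq V" and le: "\<And>n. p \<in> V n \<Longrightarrow> q \<in> V n"
  shows "nbhd_level b V p \<le> nbhd_level b V q"
proof (cases "\<forall>n. q \<in> V n")
  case True
  then show ?thesis
    using nbhd_level_bounds(2)[OF b, of V p] by (simp add: nbhd_level_def)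
next
  case False
  let ?m = "LEAST n. q \<notin> V n"
  have "q \<notin> V ?m"
    using False LeastI_ex[of "\<lambda>n. q \<notin> V n"] by blast
  then have "p \<notin> V ?m"
    using le by blast
  then have "nbhd_level b V p \<le> 1 - (1 - b) / real (Suc ?m)"
    using mem_iff_nbhd_level_gt[OF b V, of p ?m] by simp
  also have "\<dots> = nbhd_level b V q"
    unfolding nbhd_level_def using False by (simp only: if_False)
  finally show ?thesis .
qed

lemma circled_INT: "(\<And>i. i \<in> I \<Longrightarrow> circled (A i)) \<Longrightarrow> circled (\<Inter>i\<in>I. A i)"
  unfolding circled_def by blast

lemma countable_circled_base_imp_decseq:
  assumes "countable B" and base: "filter_base_of B F" and circled: "\<And>U. U \<in> B \<Longrightarrow> circled U"
  obtains V :: "nat \<Rightarrow> 'a::real_vector set"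
  where "decseq V" "\<And>n. circled (V n)" "\<And>n. V n \<in> filter_sets F"
    "\<And>U. U \<in> filter_sets F \<Longrightarrow> \<exists>n. V n \<subseteq> U"
proof
  \<comment> \<open>\<open>from_nat_into\<close> enumerates nonempty sets only.\<close>
  have "UNIV \<in> filter_sets F"
    by (simp add: filter_sets_def)
  then have ne: "B \<noteq> {}"
    using base by (auto simp: filter_base_of_def)
  define V where "V n = (\<Inter>i\<le>n. from_nat_into B i)" for n
  show "decseq V"
    unfolding V_def decseq_def by fastforce
  show "circled (V n)" for n
    unfolding V_def using from_nat_into[OF ne] circled by (intro circled_INT) auto
  have "from_nat_into B i \<in> filter_sets F" for i
    using base from_nat_into[OF ne, of i] by (auto simp: filter_base_of_def)
  then show "V n \<in> filter_sets F" for n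
    by (simp add: V_def filter_sets_def eventually_ball_finite)
  show "\<exists>n. V n \<subseteq> U" if U: "U \<in> filter_sets F" for U
  proof -
    obtain W where W: "W \<in> B" "W \<subseteq> U"
      using base U by (auto simp: filter_base_of_def)
    obtain n where "from_nat_into B n = W"
      using W(1) from_nat_into_surj[OF \<open>countable B\<close>] by blast
    then have "V n \<subseteq> U"
      using W(2) by (auto simp: V_def)
    then show ?thesis ..
  qed
qed

lemma translation_invariant_filter_sets:
  assumes ti: "translation_invariant \<U>"
  shows "U \<in> filter_sets (\<U> p) \<longleftrightarrow> (\<lambda>x. x - p) ` U \<in> filter_sets (\<U> 0)"
proof
  assume "U \<in> filter_sets (\<U> p)"
  then have "(\<lambda>x. - p + x) ` U \<in> filter_sets (\<U> (p + - p))"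
    using ti unfolding translation_invariant_def by blast
  then show "(\<lambda>x. x - p) ` U \<in> filter_sets (\<U> 0)"
    by simp
next
  assume "(\<lambda>x. x - p) ` U \<in> filter_sets (\<U> 0)"
  then have "(\<lambda>x. p + x) ` (\<lambda>x. x - p) ` U \<in> filter_sets (\<U> (0 + p))"
    using ti unfolding translation_invariant_def by blast
  then show "U \<in> filter_sets (\<U> p)"
    by (simp add: image_image)
qed

text \<open>The radii \<open>(1 - b)/(n + 1)\<close> tend to \<open>0\<close>, so the neighborhoods with these radii, which are
  the translates \<open>p + V n\<close>, already generate the filter at \<open>p\<close>.\<close>

lemma strong_generalized_topology_level_ddf:
  fixes \<U> :: "'a::real_vector \<Rightarrow> 'a filter"
  assumes ti: "translation_invariant \<U>"
    and b: "0 \<le> b" "b < 1" and V: "decseq V"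
    and circled: "\<And>n. circled (V n)"
    and nbhd: "\<And>n. V n \<in> filter_sets (\<U> 0)"
    and base: "\<And>U. U \<in> filter_sets (\<U> 0) \<Longrightarrow> \<exists>n. V n \<subseteq> U"
  shows "strong_generalized_topology (\<lambda>p. level_ddf (nbhd_level b V p)) = \<U>"
proof
  fix p
  let ?\<nu> = "\<lambda>p. level_ddf (nbhd_level b V p)"
  have D: "\<And>p. ?\<nu> p \<in> Delta_plus"
    using order_trans[OF b(1) nbhd_level_bounds(1)[OF b(2)]] nbhd_level_bounds(2)[OF b(2)]
    by (intro level_ddf_in_Delta_plus) auto
  have pos: "0 < (1 - b) / real (Suc n)" for n
    using b by simp
  have mem: "q \<in> strong_nbhd ?\<nu> p ((1 - b) / real (Suc n)) \<longleftrightarrow> q - p \<in> V n" for q n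
  proof -
    have "uminus ` V n = V n"
      using circled_imp_radial[OF circled] by (simp add: radial_def)
    then have "p - q \<in> V n \<longleftrightarrow> q - p \<in> V n"
      by (metis imageI minus_diff_eq)
    then show ?thesis
      using pos[of n] mem_iff_nbhd_level_gt[OF b(2) V, of "p - q" n]
      by (simp add: strong_nbhd_def)
  qed
  have "U \<in> filter_sets (strong_generalized_topology ?\<nu> p) \<longleftrightarrow> U \<in> filter_sets (\<U> p)" for U
  proof
    assume "U \<in> filter_sets (strong_generalized_topology ?\<nu> p)"
    then obtain t where t: "t > 0" "strong_nbhd ?\<nu> p t \<subseteq> U"
      unfolding filter_sets_strong_generalized_topology[OF D] by blast
    obtain n where "1 / real (Suc n) < t / (1 - b)"
      using nat_approx_posE[of "t / (1 - b)"] t(1) b by auto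
    then have "(1 - b) / real (Suc n) \<le> t"
      using b by (simp add: field_simps)
    then have sub: "strong_nbhd ?\<nu> p ((1 - b) / real (Suc n)) \<subseteq> U"
      using strong_nbhd_mono[of ?\<nu> "(1 - b) / real (Suc n)" t p] D t(2) by auto
    have "V n \<subseteq> (\<lambda>x. x - p) ` U"
    proof
      fix v assume "v \<in> V n"
      then have "p + v \<in> U"
        using mem[of "p + v" n] sub by auto
      then show "v \<in> (\<lambda>x. x - p) ` U"
        by (intro image_eqI[of _ _ "p + v"]) auto
    qed
    then show "U \<in> filter_sets (\<U> p)"
      using filter_sets_superset[OF nbhd] translation_invariant_filter_sets[OF ti] by blast
  next
    assume "U \<in> filter_sets (\<U> p)"
    then obtain n where n: "V n \<subseteq> (\<lambda>x. x - p) ` U"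
      using base translation_invariant_filter_sets[OF ti] by blast
    have "strong_nbhd ?\<nu> p ((1 - b) / real (Suc n)) \<subseteq> U"
    proof
      fix q assume "q \<in> strong_nbhd ?\<nu> p ((1 - b) / real (Suc n))"
      then have "q - p \<in> (\<lambda>x. x - p) ` U"
        using mem n by blast
      then show "q \<in> U"
        by auto
    qed
    then show "U \<in> filter_sets (strong_generalized_topology ?\<nu> p)"
      unfolding filter_sets_strong_generalized_topology[OF D] using pos by blast
  qed
  then show "strong_generalized_topology ?\<nu> p = \<U> p"
    unfolding filter_eq_iff_filter_sets by blast
qed

lemma countable_circled_base_imp_pn_axioms:
  fixes \<U> :: "'a::real_vector \<Rightarrow> 'a filter"
  assumes T: "t_norm T" and sup: "(SUP x\<in>{0..<1}. T x x) < 1"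
    and sep: "frechet_separated \<U>" and ti: "translation_invariant \<U>"
    and B: "countable B" "filter_base_of B (\<U> 0)" "\<And>U. U \<in> B \<Longrightarrow> circled U"
  shows "\<exists>\<nu>. pn_axioms \<nu> (tau_sup T) (tau_inf (t_conorm T)) \<and> strong_generalized_topology \<nu> = \<U>"
proof -
  define b where "b = (SUP x\<in>{0..<1}. T x x)"
  have b1: "b < 1"
    using sup by (simp add: b_def)
  have T_le: "T x y \<le> b" if "x \<in> {0..<1}" "y \<in> {0..<1}" for x y
    using t_norm_le_diagonal_SUP[OF T that] by (simp add: b_def)
  have b0: "0 \<le> b"
    using T_le[of 0 0] t_norm_unit(1)[OF T, of 0 0] by simp
  obtain V where V: "decseq V" "\<And>n. circled (V n)" "\<And>n. V n \<in> filter_sets (\<U> 0)"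
    "\<And>U. U \<in> filter_sets (\<U> 0) \<Longrightarrow> \<exists>n. V n \<subseteq> U"
    by (rule countable_circled_base_imp_decseq[OF B]) (assumption | rule that)+
  have "\<Inter>(filter_sets (\<U> 0)) = {0}"
    using sep unfolding frechet_separated_def by blast
  moreover have "(\<forall>n. p \<in> V n) \<longleftrightarrow> p \<in> \<Inter>(filter_sets (\<U> 0))" for p
    using V(3,4) by blast
  ultimately have one: "nbhd_level b V p = 1 \<longleftrightarrow> p = 0" for p
    by (simp only: nbhd_level_eq_one_iff[OF b1] singleton_iff)
  have scale: "nbhd_level b V p \<le> nbhd_level b V (l *\<^sub>R p)" if "\<bar>l\<bar> \<le> 1" for l p
    using V(2) that by (intro nbhd_level_mono b1 V(1)) (auto simp: circled_def)
  have "pn_axioms (\<lambda>p. level_ddf (nbhd_level b V p)) (tau_sup T) (tau_inf (t_conorm T))"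
    by (intro pn_axioms_level_ddf[where b = b] T T_le b0 nbhd_level_bounds b1 one scale)
  then show ?thesis
    using strong_generalized_topology_level_ddf[OF ti b0 b1 V] by blast
qed

section \<open>The characterization\<close>

theorem theorem4p2:
  fixes T :: "real \<Rightarrow> real \<Rightarrow> real"
    and \<delta> :: real
    and \<U> :: "'a::real_vector \<Rightarrow> 'a filter"
  assumes "t_norm T"
    and "(SUP x\<in>{0..<1}. T x x) < 1"
    and "\<delta> > 0"
    and "\<And>x y. x \<in> {0..1} \<Longrightarrow> y \<in> {0..1} \<Longrightarrow> x < \<delta> \<Longrightarrow> y < \<delta> \<Longrightarrow> T x y \<le> x * y"
    and "generalized_topology \<U>"
    and "frechet_separated \<U>"
    and "translation_invariant \<U>"
  shows "(triangle_function (tau_sup T) \<and> triangle_function (tau_inf (t_conorm T)) \<longrightarrow>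
           ((\<exists>\<nu>. menger_pn_space T \<nu> \<and> strong_generalized_topology \<nu> = \<U>) \<longleftrightarrow>
            (\<exists>B. countable B \<and> filter_base_of B (\<U> 0) \<and> (\<forall>U\<in>B. radial U \<and> circled U))))
       \<and> ((\<exists>\<nu>. pn_axioms \<nu> (tau_sup T) (tau_inf (t_conorm T)) \<and>
                 strong_generalized_topology \<nu> = \<U>) \<longleftrightarrow>
          (\<exists>B. countable B \<and> filter_base_of B (\<U> 0) \<and> (\<forall>U\<in>B. radial U \<and> circled U)))"
proof -
  let ?base = "\<exists>B. countable B \<and> filter_base_of B (\<U> 0) \<and> (\<forall>U\<in>B. radial U \<and> circled U)"
  let ?pn = "\<lambda>\<nu> :: 'a \<Rightarrow> ereal \<Rightarrow> real. pn_axioms \<nu> (tau_sup T) (tau_inf (t_conorm T))"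
  have iff: "(\<exists>\<nu>. ?pn \<nu> \<and> strong_generalized_topology \<nu> = \<U>) \<longleftrightarrow> ?base"
  proof
    assume "\<exists>\<nu>. ?pn \<nu> \<and> strong_generalized_topology \<nu> = \<U>"
    then obtain \<nu> where pn: "?pn \<nu>" and eq: "strong_generalized_topology \<nu> = \<U>"
      by auto
    show ?base
      using pn_axioms_imp_countable_circled_base[OF assms(1) pn] unfolding eq .
  next
    assume ?base
    then obtain B where "countable B" "filter_base_of B (\<U> 0)" "\<forall>U\<in>B. radial U \<and> circled U"
      by auto
    then show "\<exists>\<nu>. ?pn \<nu> \<and> strong_generalized_topology \<nu> = \<U>"
      using countable_circled_base_imp_pn_axioms[OF assms(1,2,6,7), of B] by simp
  qed
  show ?thesis
  proof (intro conjI impI)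
    assume "triangle_function (tau_sup T) \<and> triangle_function (tau_inf (t_conorm T))"
    then have "menger_pn_space T \<nu> \<longleftrightarrow> ?pn \<nu>" for \<nu>
      by (simp add: menger_pn_space_def pn_space_def)
    then show "(\<exists>\<nu>. menger_pn_space T \<nu> \<and> strong_generalized_topology \<nu> = \<U>) \<longleftrightarrow> ?base"
      using iff by (simp only:)
  qed (rule iff)
qed

end
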